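(* Let $\mathscr{M}$ be a statistical model, $\Psi:\mathscr{M}\to\mathbb{R}$ a pathwise differentiable parameter with efficient influence function $\phi_Q$ at each $Q\in\mathscr{M}$, let $P\in\mathscr{M}$ and $x\in\mathscr{X}(P)$. Let $H_{x,\lambda}$, $P_{\epsilon,\lambda}=(1-\epsilon)P+\epsilon H_{x,\lambda}$, the Kullback--Leibler projection $P^*_{\epsilon,\lambda}$ of $P_{\epsilon,\lambda}$, the remainder $R$ and $r(\lambda)=\|dH_{x,\lambda}/dP\|_{2,P}$ be as defined in the context, and suppose that $P^*_{\epsilon,\lambda}$ exists and is in $\mathscr{M}$ for all sufficiently small $\epsilon$ and $\lambda$. Suppose that there exists an interval $I_0=[m_0,m_1]\subset(0,+\infty)$ such that for each small $\lambda$ the Radon--Nikodym derivative of $P^*_{\epsilon,\lambda}$ relative to $P$ is uniformly contained in $I_0$ over the support of $P$ for sufficiently small $\epsilon$. Suppose also that there exists some $0<C<+\infty$ such that for any $P_1\in\mathscr{M}$ with Radon--Nikodym derivative relative to $P$ bounded above by $m_1$ over the support of $P$ we have $$|R(P_1,P)|\;\le\;C\left\|\frac{dP_1}{dP}-1\right\|_{2,P}^2.$$ Then $R(P^*_{\epsilon,\lambda},P)/[\epsilon\{1+r(\lambda)\}]^2$ is bounded for small $\lambda$ and sufficiently smaller $\epsilon$; that is, there exist $B<+\infty$, $\lambda_0>0$ and, for each $0<\lambda<\lambda_0$, some $\epsilon_0(\lambda)>0$ such that $|R(P^*_{\epsilon,\lambda},P)|\le B\,[\epsilon\{1+r(\lambda)\}]^2$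 whenever $0<\lambda<\lambda_0$ and $0<\epsilon<\epsilon_0(\lambda)$. Consequently, if $\epsilon=\epsilon(\lambda)$ is selected (with $0<\epsilon(\lambda)<\epsilon_0(\lambda)$) such that $\epsilon(\lambda)\{1+r(\lambda)\}^2\to0$ as $\lambda\to0$, then $R(P^*_{\epsilon(\lambda),\lambda},P)/\epsilon(\lambda)\to0$ as $\lambda\to0$.
   Context: Model and parameter. $\mathscr{M}$ is a collection of probability distributions on $\mathbb{R}^d$; $\mathscr{X}(P)\subseteq\mathbb{R}^d$ is the sample space associated with $P\in\mathscr{M}$. $L_2^0(P)$ is the Hilbert space of real-valued functions on $\mathscr{X}(P)$ with mean zero and finite variance under $P$. The parameter $\Psi:\mathscr{M}\to\mathbb{R}$ is pathwise differentiable at $P$ if there is $\chi_P\in L_2^0(P)$ such that, for each regular one-dimensional parametric submodel $\{P_\epsilon:\epsilon\in\mathscr{E}\}\subseteq\mathscr{M}$, with $\mathscr{E}\subset\mathbb{R}$ an interval containing zero and $P_{\epsilon=0}=P$, one has $\frac{d}{d\epsilon}\Psi(P_\epsilon)|_{\epsilon=0}=\int\chi_P(u)s(u)\,dP(u)$, where $s$ is the score for $\epsilon$ at $\epsilon=0$ in the submodel; any such $\chi_P$ is called a gradient of $\Psi$ at $P$ relative to $\mathscr{M}$. The tangent space $T_{\mathscr{M}}(P)$ is the closure in $L_2^0(P)$ of the linear span of scores at $P$ arising from regular one-dimensional parametric submodels of $\mathscr{M}$ through $P$. The efficient influence function (EIF) $\phi_P$ is the unique gradient contained in $T_{\mathscr{M}}(P)$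 (the canonical gradient). $\Psi$ is assumed pathwise differentiable, so that $\phi_Q$ is defined for $Q\in\mathscr{M}$. Remainder. For $P_1,P\in\mathscr{M}$, $R(P_1,P)$ is the remainder in the linearization $\Psi(P_1)-\Psi(P)=-\int\phi_{P_1}(u)\,dP(u)+R(P_1,P)$, i.e. $R(P_1,P):=\Psi(P_1)-\Psi(P)+\int\phi_{P_1}(u)\,dP(u)$. Perturbation and projection. For $\lambda>0$, $H_{x,\lambda}$ is a probability distribution symmetric about $x$, dominated by $P$, and such that $\int g(u)\,dH_{x,\lambda}(u)\to g(x)$ as $\lambda\to0$ for all $g$ in a sufficiently large class of functions. For $0\le\epsilon\le1$, $P_{\epsilon,\lambda}:=(1-\epsilon)P+\epsilon H_{x,\lambda}$. Let $\mathscr{M}(P):=\{P_1\in\mathscr{M}:P_1\ll P\}$ and let $\nu$ be a measure dominating $P$. The projection is $$P^*_{\epsilon,\lambda}:=\operatorname{argmax}_{P_1\in\mathscr{M}(P)}\int\log\left\{\frac{dP_1}{d\nu}(u)\right\}dP_{\epsilon,\lambda}(u).$$ Norms. $\|h\|_{2,P}:=\sqrt{\int h(u)^2\,dP(u)}$ and $r(\lambda):=\|dH_{x,\lambda}/dP\|_{2,P}$. All integrals appearing are understood to be well defined. *)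

theory Defs
  imports "HOL-Probability.Probability"
begin

text \<open>
  In the library, \<^const>\<open>absolutely_continuous\<close> applied to \<open>M N\<close> means that \<open>N\<close> is dominated by
  \<open>M\<close>, and \<^const>\<open>RN_deriv\<close> applied to \<open>M N\<close> is the density \<open>dN/dM\<close>, valued in \<^typ>\<open>ennreal\<close>.
\<close>

definition statistical_model ::
    "(real ^ 'd) measure set \<Rightarrow> ((real ^ 'd) measure \<Rightarrow> (real ^ 'd) set) \<Rightarrow> bool" where
  "statistical_model \<M> \<X> \<longleftrightarrow>
    (\<forall>Q\<in>\<M>. prob_space Q \<and> sets Q = sets borel \<and> \<X> Q \<in> sets borel \<and> (AE u in Q. u \<in> \<X> Q))"

text \<open>
  Functions on the sample space are represented by functions on the whole of Euclidean space;
  their values off the sample space lie on a null set and are irrelevant.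
\<close>

definition L20 :: "(real ^ 'd) measure \<Rightarrow> (real ^ 'd \<Rightarrow> real) set" where
  "L20 P = {f. f \<in> borel_measurable P \<and> integrable P (\<lambda>u. (f u)\<^sup>2) \<and> (\<integral>u. f u \<partial>P) = 0}"

definition L2norm :: "(real ^ 'd) measure \<Rightarrow> (real ^ 'd \<Rightarrow> real) \<Rightarrow> real" where
  "L2norm P h = sqrt (\<integral>u. (h u)\<^sup>2 \<partial>P)"

text \<open>The real-valued version of the density \<open>dN/dM\<close>.\<close>

definition dens :: "(real ^ 'd) measure \<Rightarrow> (real ^ 'd) measure \<Rightarrow> real ^ 'd \<Rightarrow> real" where
  "dens M N u = enn2real (RN_deriv M N u)"

text \<open>
  Regularity of a one-dimensional submodel is differentiability in quadratic mean at zero, and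
  the score \<open>s\<close> is the corresponding derivative. The interval may have zero as an endpoint,
  hence the one-sided limits within \<open>E\<close>; the degenerate interval \<open>{0}\<close> is excluded, since
  every function would be a score there.
\<close>

definition regular_submodel ::
    "(real ^ 'd) measure set \<Rightarrow> (real ^ 'd) measure \<Rightarrow> real set \<Rightarrow>
     (real \<Rightarrow> (real ^ 'd) measure) \<Rightarrow> (real ^ 'd \<Rightarrow> real) \<Rightarrow> bool" where
  "regular_submodel \<M> P E Pe s \<longleftrightarrow>
    is_interval E \<and> 0 \<in> E \<and> E \<noteq> {0} \<and>
    (\<forall>e\<in>E. Pe e \<in> \<M>) \<and> Pe 0 = P \<and> s \<in> L20 P \<and>
    (\<exists>\<mu>. sigma_finite_measure \<mu> \<and> sets \<mu> = sets borel \<and>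
      (\<forall>e\<in>E. absolutely_continuous \<mu> (Pe e)) \<and>
      ((\<lambda>e. \<integral>u. ((sqrt (dens \<mu> (Pe e) u) - sqrt (dens \<mu> P u)) / e
                  - s u * sqrt (dens \<mu> P u) / 2)\<^sup>2 \<partial>\<mu>) \<longlongrightarrow> 0) (at 0 within E))"

definition scores ::
    "(real ^ 'd) measure set \<Rightarrow> (real ^ 'd) measure \<Rightarrow> (real ^ 'd \<Rightarrow> real) set" where
  "scores \<M> P = {s. \<exists>E Pe. regular_submodel \<M> P E Pe s}"

definition is_gradient ::
    "(real ^ 'd) measure set \<Rightarrow> ((real ^ 'd) measure \<Rightarrow> real) \<Rightarrow> (real ^ 'd) measure \<Rightarrow>
     (real ^ 'd \<Rightarrow> real) \<Rightarrow> bool" where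
  "is_gradient \<M> \<Psi> P D \<longleftrightarrow>
    D \<in> L20 P \<and>
    (\<forall>E Pe s. regular_submodel \<M> P E Pe s \<longrightarrow>
      ((\<lambda>e. \<Psi> (Pe e)) has_real_derivative (\<integral>u. D u * s u \<partial>P)) (at 0 within E))"

definition pathwise_differentiable ::
    "(real ^ 'd) measure set \<Rightarrow> ((real ^ 'd) measure \<Rightarrow> real) \<Rightarrow> (real ^ 'd) measure \<Rightarrow> bool" where
  "pathwise_differentiable \<M> \<Psi> P \<longleftrightarrow> (\<exists>D. is_gradient \<M> \<Psi> P D)"

text \<open>The \<open>L2\<close>-closure of the set of finite linear combinations of scores.\<close>

definition tangent_space ::
    "(real ^ 'd) measure set \<Rightarrow> (real ^ 'd) measure \<Rightarrow> (real ^ 'd \<Rightarrow> real) set" where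
  "tangent_space \<M> P =
    {f \<in> L20 P. \<forall>\<delta>>0. \<exists>(n::nat) c s. (\<forall>i<n. s i \<in> scores \<M> P) \<and>
        L2norm P (\<lambda>u. f u - (\<Sum>i<n. c i * s i u)) < \<delta>}"

text \<open>The efficient influence function is unique only up to a null set, hence a predicate.\<close>

definition is_EIF ::
    "(real ^ 'd) measure set \<Rightarrow> ((real ^ 'd) measure \<Rightarrow> real) \<Rightarrow> (real ^ 'd) measure \<Rightarrow>
     (real ^ 'd \<Rightarrow> real) \<Rightarrow> bool" where
  "is_EIF \<M> \<Psi> P \<phi> \<longleftrightarrow> is_gradient \<M> \<Psi> P \<phi> \<and> \<phi> \<in> tangent_space \<M> P"

definition remainder ::
    "((real ^ 'd) measure \<Rightarrow> real) \<Rightarrow> ((real ^ 'd) measure \<Rightarrow> real ^ 'd \<Rightarrow> real) \<Rightarrow>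
     (real ^ 'd) measure \<Rightarrow> (real ^ 'd) measure \<Rightarrow> real" where
  "remainder \<Psi> \<phi> P1 P = \<Psi> P1 - \<Psi> P + (\<integral>u. \<phi> P1 u \<partial>P)"

text \<open>
  \<open>G\<close> is the class of functions along which the integrals converge. Symmetry about \<open>x\<close> is
  invariance under the reflection in \<open>x\<close>.
\<close>

definition approximating_family ::
    "(real ^ 'd) measure \<Rightarrow> real ^ 'd \<Rightarrow> (real ^ 'd \<Rightarrow> real) set \<Rightarrow>
     (real \<Rightarrow> (real ^ 'd) measure) \<Rightarrow> bool" where
  "approximating_family P x G H \<longleftrightarrow>
    (\<forall>l>0. prob_space (H l) \<and> sets (H l) = sets borel \<and>
      distr (H l) borel (\<lambda>u. 2 *\<^sub>R x - u) = H l \<and> absolutely_continuous P (H l)) \<and>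
    (\<forall>g\<in>G. (\<forall>\<^sub>F l in at_right 0. integrable (H l) g) \<and>
      ((\<lambda>l. \<integral>u. g u \<partial>H l) \<longlongrightarrow> g x) (at_right 0))"

definition mixture ::
    "real \<Rightarrow> (real ^ 'd) measure \<Rightarrow> (real ^ 'd) measure \<Rightarrow> (real ^ 'd) measure" where
  "mixture e P Q =
    measure_of (space P) (sets P) (\<lambda>A. ennreal (1 - e) * emeasure P A + ennreal e * emeasure Q A)"

lemma space_mixture [simp]: "space (mixture e P Q) = space P"
  and sets_mixture [simp]: "sets (mixture e P Q) = sets P"
  by (simp_all add: mixture_def)

lemma emeasure_mixture:
  assumes "sets Q = sets P" and "A \<in> sets P"
  shows "emeasure (mixture e P Q) A = ennreal (1 - e) * emeasure P A + ennreal e * emeasure Q A"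
proof (rule emeasure_measure_of[OF mixture_def])
  show "sets P \<subseteq> Pow (space P)" by (rule sets.space_closed)
  show "positive (sets (mixture e P Q))
      (\<lambda>A. ennreal (1 - e) * emeasure P A + ennreal e * emeasure Q A)"
    by (simp add: positive_def)
  show "countably_additive (sets (mixture e P Q))
      (\<lambda>A. ennreal (1 - e) * emeasure P A + ennreal e * emeasure Q A)"
  proof (rule countably_additiveI)
    fix B :: "nat \<Rightarrow> _"
    assume "range B \<subseteq> sets (mixture e P Q)" and dis: "disjoint_family B"
    then have "range B \<subseteq> sets P" "range B \<subseteq> sets Q" using assms(1) by simp_all
    then show "(\<Sum>i. ennreal (1 - e) * emeasure P (B i) + ennreal e * emeasure Q (B i)) =
        ennreal (1 - e) * emeasure P (\<Union>i. B i) + ennreal e * emeasure Q (\<Union>i. B i)"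
      by (simp add: suminf_add[symmetric] ennreal_suminf_cmult suminf_emeasure[OF _ dis])
  qed
  show "A \<in> sets (mixture e P Q)" using assms(2) by simp
qed

text \<open>
  The library's \<^const>\<open>ln\<close> vanishes at zero, so log-densities take their values in the
  extended reals, with \<open>log 0 = -\<infinity>\<close>.
\<close>

definition log_ext :: "ennreal \<Rightarrow> ereal" where
  "log_ext y = (if y = 0 then -\<infinity> else if y = \<top> then \<infinity> else ereal (ln (enn2real y)))"

definition loglik_pos ::
    "(real ^ 'd) measure \<Rightarrow> (real ^ 'd) measure \<Rightarrow> (real ^ 'd) measure \<Rightarrow> ennreal" where
  "loglik_pos \<nu> Q P1 = (\<integral>\<^sup>+u. e2ennreal (log_ext (RN_deriv \<nu> P1 u)) \<partial>Q)"

definition loglik_neg ::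
    "(real ^ 'd) measure \<Rightarrow> (real ^ 'd) measure \<Rightarrow> (real ^ 'd) measure \<Rightarrow> ennreal" where
  "loglik_neg \<nu> Q P1 = (\<integral>\<^sup>+u. e2ennreal (- log_ext (RN_deriv \<nu> P1 u)) \<partial>Q)"

text \<open>
  The extended-real integral \<open>\<integral> log (dP1/d\<nu>) dQ\<close>; \<^const>\<open>e2ennreal\<close> truncates at zero, so the two
  terms are the integrals of the positive and negative parts.
\<close>

definition loglik ::
    "(real ^ 'd) measure \<Rightarrow> (real ^ 'd) measure \<Rightarrow> (real ^ 'd) measure \<Rightarrow> ereal" where
  "loglik \<nu> Q P1 = enn2ereal (loglik_pos \<nu> Q P1) - enn2ereal (loglik_neg \<nu> Q P1)"

definition loglik_defined ::
    "(real ^ 'd) measure \<Rightarrow> (real ^ 'd) measure \<Rightarrow> (real ^ 'd) measure \<Rightarrow> bool" where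
  "loglik_defined \<nu> Q P1 \<longleftrightarrow> loglik_pos \<nu> Q P1 < \<top> \<or> loglik_neg \<nu> Q P1 < \<top>"

text \<open>
  \<open>Pstar\<close> maximises the log-likelihood under \<open>Q\<close> over the members of the model dominated by
  \<open>P\<close>. Finiteness of the maximum is part of its existence: if it were infinite, the
  maximisation would not single out any distribution.
\<close>

definition is_KL_projection ::
    "(real ^ 'd) measure set \<Rightarrow> (real ^ 'd) measure \<Rightarrow> (real ^ 'd) measure \<Rightarrow>
     (real ^ 'd) measure \<Rightarrow> (real ^ 'd) measure \<Rightarrow> bool" where
  "is_KL_projection \<M> P \<nu> Q Pstar \<longleftrightarrow>
    is_arg_max (loglik \<nu> Q)
      (\<lambda>P1. P1 \<in> \<M> \<and> absolutely_continuous P P1 \<and> loglik_defined \<nu> Q P1) Pstar \<and>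
    \<bar>loglik \<nu> Q Pstar\<bar> \<noteq> \<infinity>"

end

theory Submission
  imports Defs
begin

text \<open>
  Write \<open>p = dP*/dP\<close> and \<open>h = dH/dP\<close>, so that the mixture has density \<open>1 + \<epsilon> (h - 1)\<close> with respect
  to \<open>P\<close>. Since \<open>P\<close> itself competes in the maximisation defining \<open>P*\<close>, and log-densities with
  respect to \<open>\<nu>\<close> differ by \<open>ln p\<close>, optimality says
  \<open>0 \<le> \<integral> (1 + \<epsilon> (h - 1)) ln p dP\<close>
  (lemma \<open>KL_projection_ln_dens_nonneg\<close>). This pits two effects against each other. The main term
  \<open>\<integral> ln p dP\<close> is minus a Kullback--Leibler divergence; because \<open>p \<le> m1\<close> and \<open>p - 1\<close> has mean zero,
  it is at most \<open>- \<parallel>p - 1\<parallel>\<^sup>2 / (2 m1)\<close>. The perturbation \<open>\<epsilon> \<integral> (h - 1) ln p dP\<close> is only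
  linear in \<open>p - 1\<close>: because \<open>p \<ge> m0\<close>, it is at most of order \<open>\<epsilon> \<parallel>h - 1\<parallel> \<parallel>p - 1\<parallel> / m0\<close>. A quadratic
  loss can be compensated by a linear gain only if
  \<open>\<parallel>p - 1\<parallel> \<le> (2 m1 / m0) \<epsilon> \<parallel>h - 1\<parallel>\<close>
  (lemma \<open>L2_bound_of_ln_gain\<close>), and \<open>\<parallel>h - 1\<parallel>\<^sup>2 = r\<^sup>2 - 1\<close>. The quadratic bound on the remainder then
  gives the claim with \<open>B = C (2 m1 / m0)\<^sup>2\<close>.
\<close>

section \<open>Quadratic and linear bounds for the logarithm\<close>

text \<open>
  The right side minus the left has derivative \<open>(t - 1) (1/t - 1/m)\<close>, which changes sign only at
  \<open>t = 1\<close> as long as \<open>t \<le> m\<close>; so the difference is smallest, namely zero, at \<open>t = 1\<close>.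
\<close>

lemma ln_le_tangent_minus_square:
  fixes t m :: real
  assumes "0 < t" "t \<le> m" "1 \<le> m"
  shows "ln t \<le> (t - 1) - (t - 1)\<^sup>2 / (2 * m)"
proof -
  define f where "f s = (s - 1) - (s - 1)\<^sup>2 / (2 * m) - ln s" for s :: real
  have der: "(f has_real_derivative (s - 1) * (1 / s - 1 / m)) (at s)" if "0 < s" for s
  proof -
    have "(f has_real_derivative 1 - 2 * (s - 1) / (2 * m) - 1 / s) (at s)"
      unfolding f_def using that assms
      by (auto intro!: derivative_eq_intros simp: frac_eq_eq algebra_simps)
    also have "1 - 2 * (s - 1) / (2 * m) - 1 / s = (s - 1) * (1 / s - 1 / m)"
      using that assms by (simp add: field_simps)
    finally show ?thesis .
  qed
  have inv: "1 / m \<le> 1 / s" if "0 < s" "s \<le> m" for s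
    using that by (simp add: frac_le)
  have "f 1 \<le> f t"
  proof (cases "1 \<le> t")
    case True
    show ?thesis
    proof (rule DERIV_nonneg_imp_nondecreasing[OF True, of f])
      fix s assume s: "1 \<le> s" "s \<le> t"
      then have "0 \<le> (s - 1) * (1 / s - 1 / m)" using inv[of s] assms by simp
      then show "\<exists>y. (f has_real_derivative y) (at s) \<and> 0 \<le> y" using der[of s] s by (intro exI conjI) auto
    qed
  next
    case False
    show ?thesis
    proof (rule DERIV_nonpos_imp_nonincreasing[of t 1 f])
      show "t \<le> 1" using False by simp
      fix s assume s: "t \<le> s" "s \<le> 1"
      then have "(s - 1) * (1 / s - 1 / m) \<le> 0"
        using inv[of s] assms by (intro mult_nonpos_nonneg) auto
      then show "\<exists>y. (f has_real_derivative y) (at s) \<and> y \<le> 0" using der[of s] s assms by (intro exI conjI) auto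
    qed
  qed
  then show ?thesis by (simp add: f_def)
qed

lemma abs_ln_le_of_lower_bound:
  fixes t m :: real
  assumes "0 < m" "m \<le> 1" "m \<le> t"
  shows "\<bar>ln t\<bar> \<le> \<bar>t - 1\<bar> / m"
proof (cases "1 \<le> t")
  case True
  have "ln t \<le> t - 1" using True by (intro ln_le_minus_one) auto
  also have "\<dots> \<le> (t - 1) / m" using assms True by (simp add: le_divide_eq mult_left_le)
  finally show ?thesis using True by simp
next
  case False
  have t: "0 < t" using assms by simp
  have "- ln t = ln (1 / t)" using t by (simp add: ln_div)
  also have "\<dots> \<le> 1 / t - 1" using t by (intro ln_le_minus_one) auto
  also have "\<dots> = (1 - t) / t" using t by (simp add: field_simps)
  also have "\<dots> \<le> (1 - t) / m" using assms False by (intro divide_left_mono) auto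
  finally show ?thesis using False t by simp
qed

text \<open>
  The quadratic loss in \<open>ln t\<close> absorbs half of the perturbation \<open>e k ln t\<close> by the inequality between
  arithmetic and geometric means, at the price of a term in \<open>k\<^sup>2\<close> that does not depend on \<open>t\<close>.
\<close>

lemma perturbed_ln_bound:
  fixes t e k m0 m1 :: real
  assumes "0 < m0" "m0 \<le> 1" "1 \<le> m1" "m0 \<le> t" "t \<le> m1" "0 \<le> e"
  shows "(1 + e * k) * ln t \<le> (t - 1) - (t - 1)\<^sup>2 / (4 * m1) + m1 * (e / m0)\<^sup>2 * k\<^sup>2"
proof -
  define a where "a = \<bar>t - 1\<bar>"
  define b where "b = e * \<bar>k\<bar> / m0"
  have "e * k * ln t \<le> \<bar>e * k * ln t\<bar>" by (rule abs_ge_self)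
  also have "\<dots> = e * \<bar>k\<bar> * \<bar>ln t\<bar>" using assms(6) by (simp add: abs_mult)
  also have "\<dots> \<le> e * \<bar>k\<bar> * (\<bar>t - 1\<bar> / m0)"
    using assms by (intro mult_left_mono abs_ln_le_of_lower_bound) auto
  also have "\<dots> = a * b" by (simp add: a_def b_def)
  also have "\<dots> \<le> a\<^sup>2 / (4 * m1) + m1 * b\<^sup>2"
  proof -
    have "0 \<le> (a - 2 * m1 * b)\<^sup>2 / (4 * m1)" using assms by simp
    also have "\<dots> = a\<^sup>2 / (4 * m1) + m1 * b\<^sup>2 - a * b"
      using assms by (simp add: field_simps power2_eq_square)
    finally show ?thesis by simp
  qed
  finally have "e * k * ln t \<le> (t - 1)\<^sup>2 / (4 * m1) + m1 * (e / m0)\<^sup>2 * k\<^sup>2"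
    by (simp add: a_def b_def power_divide power_mult_distrib)
  moreover have "ln t \<le> (t - 1) - (t - 1)\<^sup>2 / (2 * m1)"
    using assms by (intro ln_le_tangent_minus_square) auto
  moreover have "(t - 1)\<^sup>2 / (2 * m1) = 2 * ((t - 1)\<^sup>2 / (4 * m1))" by simp
  moreover have "(1 + e * k) * ln t = ln t + e * k * ln t" by (simp add: distrib_right)
  ultimately show ?thesis by linarith
qed

section \<open>Distance of a gainful density from one\<close>

text \<open>
  Integrating \<open>perturbed_ln_bound\<close> removes its linear term, since \<open>p - 1\<close> has mean zero.
\<close>

lemma (in prob_space) L2_bound_of_ln_gain:
  fixes p h :: "'a \<Rightarrow> real"
  assumes meas [measurable]: "p \<in> borel_measurable M" "h \<in> borel_measurable M"
    and m0: "0 < m0" and e: "0 \<le> e"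
    and bounds: "AE u in M. m0 \<le> p u \<and> p u \<le> m1"
    and p1: "(\<integral>u. p u \<partial>M) = 1" and h1: "(\<integral>u. h u \<partial>M) = 1"
    and h2: "integrable M (\<lambda>u. (h u)\<^sup>2)"
    and gain: "0 \<le> (\<integral>u. (1 + e * (h u - 1)) * ln (p u) \<partial>M)"
  shows "(\<integral>u. (p u - 1)\<^sup>2 \<partial>M) \<le> (2 * m1 / m0 * e)\<^sup>2 * ((\<integral>u. (h u)\<^sup>2 \<partial>M) - 1)"
proof -
  have int_h: "integrable M h" by (rule square_integrable_imp_integrable[OF meas(2) h2])
  have int_p: "integrable M p"
    using bounds m0 by (intro integrable_const_bound[of _ m1]) auto
  \<comment> \<open>The mean of \<open>p\<close>, which is one, lies between the pointwise bounds.\<close>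
  have m0_le: "m0 \<le> 1"
    using integral_mono_AE[OF integrable_const int_p, of m0] bounds p1 by (simp add: prob_space)
  have m1_ge: "1 \<le> m1"
    using integral_mono_AE[OF int_p integrable_const, of m1] bounds p1 by (simp add: prob_space)
  \<comment> \<open>For \<open>0 \<le> p u \<le> m1\<close>, the crude bound \<open>m1 + 1\<close> on \<open>\<bar>p u - 1\<bar>\<close> covers both signs.\<close>
  have int_p2: "integrable M (\<lambda>u. (p u - 1)\<^sup>2)"
  proof (rule integrable_const_bound[of _ "(m1 + 1)\<^sup>2"])
    show "AE u in M. norm ((p u - 1)\<^sup>2) \<le> (m1 + 1)\<^sup>2"
      using bounds
    proof eventually_elim
      case (elim u)
      then have "\<bar>p u - 1\<bar> \<le> \<bar>m1 + 1\<bar>" using m0 m1_ge by arith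
      then show ?case by (simp add: abs_le_square_iff)
    qed
  qed simp
  have h_expand: "(h u - 1)\<^sup>2 = (h u)\<^sup>2 - 2 * h u + 1" for u
    by (simp add: power2_eq_square algebra_simps)
  have int_k2: "integrable M (\<lambda>u. (h u - 1)\<^sup>2)"
    unfolding h_expand using h2 int_h by simp
  have k2: "(\<integral>u. (h u - 1)\<^sup>2 \<partial>M) = (\<integral>u. (h u)\<^sup>2 \<partial>M) - 1"
    unfolding h_expand using h2 int_h h1 by (simp add: prob_space)
  have int_ln: "integrable M (\<lambda>u. (1 + e * (h u - 1)) * ln (p u))"
  proof (rule Bochner_Integration.integrable_bound)
    show "integrable M (\<lambda>u. (1 + e * (h u - 1)) * ((m1 + 1) / m0))"
      using int_h by simp
    show "AE u in M. norm ((1 + e * (h u - 1)) * ln (p u))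
        \<le> norm ((1 + e * (h u - 1)) * ((m1 + 1) / m0))"
      using bounds
    proof eventually_elim
      case (elim u)
      have "\<bar>ln (p u)\<bar> \<le> \<bar>p u - 1\<bar> / m0"
        using elim m0 m0_le by (intro abs_ln_le_of_lower_bound) auto
      also have "\<dots> \<le> (m1 + 1) / m0"
        using elim m0 m1_ge by (intro divide_right_mono) auto
      also have "\<dots> = \<bar>(m1 + 1) / m0\<bar>" using m0 m1_ge by simp
      finally show ?case by (simp only: real_norm_def abs_mult mult_left_mono abs_ge_zero)
    qed
  qed simp
  let ?K = "m1 * (e / m0)\<^sup>2"
  have "0 \<le> (\<integral>u. (1 + e * (h u - 1)) * ln (p u) \<partial>M)" by (rule gain)
  also have "\<dots> \<le> (\<integral>u. (p u - 1) - (p u - 1)\<^sup>2 / (4 * m1) + ?K * (h u - 1)\<^sup>2 \<partial>M)"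
  proof (rule integral_mono_AE[OF int_ln])
    show "integrable M (\<lambda>u. (p u - 1) - (p u - 1)\<^sup>2 / (4 * m1) + ?K * (h u - 1)\<^sup>2)"
      using int_p int_p2 int_k2 by simp
    show "AE u in M. (1 + e * (h u - 1)) * ln (p u)
        \<le> (p u - 1) - (p u - 1)\<^sup>2 / (4 * m1) + ?K * (h u - 1)\<^sup>2"
      using bounds
    proof eventually_elim
      case (elim u)
      then show ?case using m0 m0_le m1_ge e by (intro perturbed_ln_bound) auto
    qed
  qed
  also have "\<dots> = - (\<integral>u. (p u - 1)\<^sup>2 \<partial>M) / (4 * m1) + ?K * ((\<integral>u. (h u)\<^sup>2 \<partial>M) - 1)"
    using int_p int_p2 int_k2 p1 by (simp add: k2[symmetric] prob_space)
  finally have "(\<integral>u. (p u - 1)\<^sup>2 \<partial>M) \<le> 4 * m1 * (?K * ((\<integral>u. (h u)\<^sup>2 \<partial>M) - 1))"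
    using m1_ge by (simp add: field_simps)
  also have "\<dots> = (2 * m1 / m0 * e)\<^sup>2 * ((\<integral>u. (h u)\<^sup>2 \<partial>M) - 1)"
    by (simp add: power2_eq_square)
  finally show ?thesis .
qed

section \<open>Densities\<close>

lemma AE_ennreal_dens:
  assumes "sigma_finite_measure M" "prob_space N" "absolutely_continuous M N" "sets N = sets M"
  shows "AE u in M. RN_deriv M N u = ennreal (dens M N u)"
proof -
  interpret sigma_finite_measure M by fact
  interpret N: prob_space N by fact
  have "AE u in M. RN_deriv M N u \<noteq> \<infinity>"
    by (rule RN_deriv_finite) (use assms N.sigma_finite_measure in auto)
  then show ?thesis
    by eventually_elim (simp add: dens_def top.not_eq_extremum)
qed

lemma dens_nonneg: "0 \<le> dens M N u"
  by (simp add: dens_def)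

lemma borel_measurable_dens [measurable]: "dens M N \<in> borel_measurable M"
  unfolding dens_def[abs_def] by measurable

lemma density_dens:
  assumes "sigma_finite_measure M" "prob_space N" "absolutely_continuous M N" "sets N = sets M"
  shows "density M (\<lambda>u. ennreal (dens M N u)) = N"
proof -
  interpret sigma_finite_measure M by fact
  have "density M (\<lambda>u. ennreal (dens M N u)) = density M (RN_deriv M N)"
  proof (rule density_cong)
    show "AE u in M. ennreal (dens M N u) = RN_deriv M N u"
      using AE_ennreal_dens[OF assms] by eventually_elim simp
  qed simp_all
  then show ?thesis using assms by (simp add: density_RN_deriv)
qed

lemma integral_dens_eq_1:
  assumes "sigma_finite_measure M" "prob_space N" "absolutely_continuous M N" "sets N = sets M"
  shows "(\<integral>u. dens M N u \<partial>M) = 1"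
proof -
  interpret N: prob_space N by fact
  have "1 = (\<integral>u. (1::real) \<partial>density M (\<lambda>u. ennreal (dens M N u)))"
    unfolding density_dens[OF assms] by (simp add: N.prob_space)
  also have "\<dots> = (\<integral>u. dens M N u \<partial>M)"
    by (subst integral_density) (auto simp: dens_nonneg)
  finally show ?thesis by simp
qed

text \<open>
  The mixture is a small perturbation of \<open>P\<close>: its density deviates from one by \<open>e\<close> times a function
  of mean zero.
\<close>

lemma mixture_eq_density:
  assumes "prob_space P" "prob_space Q" "absolutely_continuous P Q" "sets Q = sets P"
    and e: "0 \<le> e" "e \<le> 1"
  shows "mixture e P Q = density P (\<lambda>u. ennreal (1 + e * (dens P Q u - 1)))"
proof (rule measure_eqI)
  interpret P: prob_space P by fact
  fix A assume "A \<in> sets (mixture e P Q)"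
  then have [measurable]: "A \<in> sets P" by simp
  have "ennreal (1 + e * (dens P Q u - 1)) * indicator A u
      = ennreal (1 - e) * indicator A u + ennreal e * (ennreal (dens P Q u) * indicator A u)" for u
  proof -
    have "ennreal (1 + e * (dens P Q u - 1)) = ennreal ((1 - e) + e * dens P Q u)"
      by (simp add: algebra_simps)
    also have "\<dots> = ennreal (1 - e) + ennreal e * ennreal (dens P Q u)"
      using e dens_nonneg[of P Q u] by (simp add: ennreal_mult)
    finally show ?thesis by (simp add: indicator_def)
  qed
  then have "emeasure (density P (\<lambda>u. ennreal (1 + e * (dens P Q u - 1)))) A
      = ennreal (1 - e) * emeasure P A
        + ennreal e * emeasure (density P (\<lambda>u. ennreal (dens P Q u))) A"
    by (simp add: emeasure_density nn_integral_add nn_integral_cmult)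
  also have "\<dots> = emeasure (mixture e P Q) A"
    using assms density_dens[OF P.sigma_finite_measure assms(2-4)] by (simp add: emeasure_mixture)
  finally show "emeasure (mixture e P Q) A
      = emeasure (density P (\<lambda>u. ennreal (1 + e * (dens P Q u - 1)))) A" by simp
qed simp

lemma RN_deriv_chain_rule:
  assumes "sigma_finite_measure \<nu>" "sigma_finite_measure P"
    and ac: "absolutely_continuous \<nu> P" "absolutely_continuous P P1"
    and sets: "sets P = sets \<nu>" "sets P1 = sets P"
  shows "AE u in \<nu>. RN_deriv \<nu> P1 u = RN_deriv \<nu> P u * RN_deriv P P1 u"
proof -
  interpret \<nu>: sigma_finite_measure \<nu> by fact
  interpret P: sigma_finite_measure P by fact
  have [measurable]: "RN_deriv P P1 \<in> borel_measurable \<nu>"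
    using borel_measurable_RN_deriv[of P P1] measurable_cong_sets[OF sets(1) refl] by blast
  have "density \<nu> (\<lambda>u. RN_deriv \<nu> P u * RN_deriv P P1 u)
      = density (density \<nu> (RN_deriv \<nu> P)) (RN_deriv P P1)"
    by (simp add: density_density_eq)
  also have "\<dots> = P1" using ac sets by (simp add: \<nu>.density_RN_deriv P.density_RN_deriv)
  finally have "AE u in \<nu>. RN_deriv \<nu> P u * RN_deriv P P1 u = RN_deriv \<nu> P1 u"
    by (intro \<nu>.RN_deriv_unique) simp_all
  then show ?thesis by eventually_elim simp
qed

lemma AE_RN_deriv_pos:
  assumes "sigma_finite_measure \<nu>" "absolutely_continuous \<nu> P" "sets P = sets \<nu>"
  shows "AE u in P. 0 < RN_deriv \<nu> P u"
proof -
  interpret sigma_finite_measure \<nu> by fact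
  have "AE u in density \<nu> (RN_deriv \<nu> P). 0 < RN_deriv \<nu> P u"
    by (subst AE_density) auto
  then show ?thesis by (simp only: density_RN_deriv[OF assms(2,3)])
qed

section \<open>Optimality of the projection\<close>

text \<open>
  Where the density is positive and finite, the extended-real log-likelihood is an ordinary
  Lebesgue integral: extended subtraction \<open>\<infinity> - \<infinity>\<close> yields \<open>\<infinity>\<close>, so a finite value forces both parts
  to be finite.
\<close>

lemma
  assumes sets: "sets Q = sets \<nu>"
    and pos: "AE u in Q. RN_deriv \<nu> P1 u = ennreal (dens \<nu> P1 u) \<and> 0 < dens \<nu> P1 u"
  shows integrable_ln_dens_if_loglik_finite:
      "\<bar>loglik \<nu> Q P1\<bar> \<noteq> \<infinity> \<Longrightarrow> integrable Q (\<lambda>u. ln (dens \<nu> P1 u))"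
    and loglik_eq_integral:
      "integrable Q (\<lambda>u. ln (dens \<nu> P1 u)) \<Longrightarrow>
        loglik_defined \<nu> Q P1 \<and> loglik \<nu> Q P1 = ereal (\<integral>u. ln (dens \<nu> P1 u) \<partial>Q)"
proof -
  let ?g = "\<lambda>u. ln (dens \<nu> P1 u)"
  have "dens \<nu> P1 \<in> borel_measurable Q"
    using borel_measurable_dens[of \<nu> P1] measurable_cong_sets[OF sets refl] by blast
  then have meas: "?g \<in> borel_measurable Q" by measurable
  have log: "AE u in Q. log_ext (RN_deriv \<nu> P1 u) = ereal (?g u)"
    using pos by eventually_elim (auto simp: log_ext_def)
  have pos_eq: "loglik_pos \<nu> Q P1 = (\<integral>\<^sup>+u. ennreal (?g u) \<partial>Q)"
    unfolding loglik_pos_def using log by (intro nn_integral_cong_AE) (auto elim!: eventually_mono)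
  have neg_eq: "loglik_neg \<nu> Q P1 = (\<integral>\<^sup>+u. ennreal (- ?g u) \<partial>Q)"
    unfolding loglik_neg_def using log by (intro nn_integral_cong_AE) (auto elim!: eventually_mono)
  have fin_iff: "integrable Q ?g \<longleftrightarrow> loglik_pos \<nu> Q P1 \<noteq> \<top> \<and> loglik_neg \<nu> Q P1 \<noteq> \<top>"
    using meas by (simp add: real_integrable_def pos_eq neg_eq)
  show "integrable Q ?g" if "\<bar>loglik \<nu> Q P1\<bar> \<noteq> \<infinity>"
    using that unfolding fin_iff loglik_def
    by (cases "loglik_pos \<nu> Q P1"; cases "loglik_neg \<nu> Q P1") auto
  show "loglik_defined \<nu> Q P1 \<and> loglik \<nu> Q P1 = ereal (\<integral>u. ?g u \<partial>Q)" if int: "integrable Q ?g"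
  proof
    show "loglik_defined \<nu> Q P1"
      using int unfolding fin_iff loglik_defined_def by (simp add: top.not_eq_extremum)
    show "loglik \<nu> Q P1 = ereal (\<integral>u. ?g u \<partial>Q)"
      using int unfolding real_lebesgue_integral_def[OF int] fin_iff loglik_def
        pos_eq[symmetric] neg_eq[symmetric]
      by (cases "loglik_pos \<nu> Q P1"; cases "loglik_neg \<nu> Q P1") auto
  qed
qed

text \<open>
  Comparison of the projection with the competitor \<open>P\<close>. The lower and upper bounds on the density
  make the difference of the two log-likelihoods a bounded function, so that finiteness of the maximum
  carries over to the log-likelihood of \<open>P\<close> and the two may be subtracted; this also frees the
  conclusion from \<open>\<nu>\<close>.
\<close>

lemma KL_projection_ln_dens_nonneg:
  fixes P :: "(real ^ 'd) measure"
  assumes proj: "is_KL_projection \<M> P \<nu> Q P1"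
    and P: "P \<in> \<M>" "prob_space P"
    and \<nu>: "sigma_finite_measure \<nu>" "absolutely_continuous \<nu> P"
    and Q: "finite_measure Q" "absolutely_continuous P Q"
    and P1: "prob_space P1"
    and sets: "sets P = sets \<nu>" "sets Q = sets P" "sets P1 = sets P"
    and bounds: "AE u in P. m0 \<le> dens P P1 u \<and> dens P P1 u \<le> m1" and m0: "0 < m0"
  shows "0 \<le> (\<integral>u. ln (dens P P1 u) \<partial>Q)"
proof -
  interpret P: prob_space P by fact
  interpret Q: finite_measure Q by fact
  have opt: "loglik \<nu> Q P' \<le> loglik \<nu> Q P1"
    if "P' \<in> \<M>" "absolutely_continuous P P'" "loglik_defined \<nu> Q P'" for P'
    using proj that by (auto simp: is_KL_projection_def is_arg_max_linorder)
  have ac: "absolutely_continuous P P1" and fin: "\<bar>loglik \<nu> Q P1\<bar> \<noteq> \<infinity>"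
    using proj by (auto simp: is_KL_projection_def is_arg_max_linorder)
  have AE_P: "AE u in P. R u" if "AE u in \<nu>. R u" for R
    using absolutely_continuous_AE[OF sets(1) \<nu>(2) that] .
  have AE_Q: "AE u in Q. R u" if "AE u in P. R u" for R
    using absolutely_continuous_AE[OF sets(2) Q(2) that] .
  have P_dens: "AE u in P. RN_deriv \<nu> P u = ennreal (dens \<nu> P u)"
    by (rule AE_P[OF AE_ennreal_dens[OF \<nu>(1) P(2) \<nu>(2) sets(1)]])
  have chain: "AE u in P. RN_deriv \<nu> P1 u = RN_deriv \<nu> P u * RN_deriv P P1 u"
    by (rule AE_P[OF RN_deriv_chain_rule[OF \<nu>(1) P.sigma_finite_measure \<nu>(2) ac sets(1,3)]])
  have "AE u in P. (RN_deriv \<nu> P u = ennreal (dens \<nu> P u) \<and> 0 < dens \<nu> P u) \<and>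
      (RN_deriv \<nu> P1 u = ennreal (dens \<nu> P1 u) \<and> 0 < dens \<nu> P1 u) \<and>
      ln (dens \<nu> P1 u) = ln (dens \<nu> P u) + ln (dens P P1 u)"
    using P_dens AE_RN_deriv_pos[OF \<nu> sets(1)] chain bounds
      AE_ennreal_dens[OF P.sigma_finite_measure P1 ac sets(3)]
  proof eventually_elim
    case (elim u)
    have a: "0 < dens \<nu> P u" using elim(1,2) by (metis ennreal_less_zero_iff)
    have b: "0 < dens P P1 u" using elim(4) m0 by simp
    have c: "RN_deriv \<nu> P1 u = ennreal (dens \<nu> P u * dens P P1 u)"
      using elim(1,3,5) a b by (simp add: ennreal_mult)
    then have "dens \<nu> P1 u = dens \<nu> P u * dens P P1 u"
      using a b by (simp add: dens_def[of \<nu> P1])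
    then show ?case using a b c elim(1) by (simp add: ln_mult)
  qed
  from AE_Q[OF this]
  have pos_P: "AE u in Q. RN_deriv \<nu> P u = ennreal (dens \<nu> P u) \<and> 0 < dens \<nu> P u"
    and pos_P1: "AE u in Q. RN_deriv \<nu> P1 u = ennreal (dens \<nu> P1 u) \<and> 0 < dens \<nu> P1 u"
    and ln_eq: "AE u in Q. ln (dens \<nu> P1 u) = ln (dens \<nu> P u) + ln (dens P P1 u)"
    by (auto elim: eventually_mono)
  have sets_Q: "sets Q = sets \<nu>" using sets by simp
  have meas_\<nu>: "dens \<nu> R \<in> borel_measurable Q" for R
    using borel_measurable_dens[of \<nu> R] measurable_cong_sets[OF sets_Q refl] by blast
  have meas_P: "dens P P1 \<in> borel_measurable Q"
    using borel_measurable_dens[of P P1] measurable_cong_sets[OF sets(2) refl] by blast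
  note [measurable] = meas_\<nu> meas_P
  have int_P1: "integrable Q (\<lambda>u. ln (dens \<nu> P1 u))"
    by (rule integrable_ln_dens_if_loglik_finite[OF sets_Q pos_P1 fin])
  have int_ln: "integrable Q (\<lambda>u. ln (dens P P1 u))"
  proof (rule Q.integrable_const_bound[of _ "\<bar>ln m0\<bar> + \<bar>ln m1\<bar>"])
    show "AE u in Q. norm (ln (dens P P1 u)) \<le> \<bar>ln m0\<bar> + \<bar>ln m1\<bar>"
      using AE_Q[OF bounds]
    proof eventually_elim
      case (elim u)
      then have "ln m0 \<le> ln (dens P P1 u)" "ln (dens P P1 u) \<le> ln m1" using m0 by auto
      then show ?case by simp
    qed
  qed simp
  have "integrable Q (\<lambda>u. ln (dens \<nu> P1 u) - ln (dens P P1 u))"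
    using int_P1 int_ln by simp
  then have int_P: "integrable Q (\<lambda>u. ln (dens \<nu> P u))"
    by (rule integrable_cong_AE_imp) (use ln_eq in \<open>auto elim: eventually_mono\<close>)
  have "ereal (\<integral>u. ln (dens \<nu> P u) \<partial>Q) \<le> ereal (\<integral>u. ln (dens \<nu> P1 u) \<partial>Q)"
    using opt[OF P(1)] loglik_eq_integral[OF sets_Q pos_P int_P]
      loglik_eq_integral[OF sets_Q pos_P1 int_P1] by (simp add: absolutely_continuous_def)
  also have "(\<integral>u. ln (dens \<nu> P1 u) \<partial>Q) = (\<integral>u. ln (dens \<nu> P u) + ln (dens P P1 u) \<partial>Q)"
    by (rule integral_cong_AE) (use ln_eq in auto)
  finally show ?thesis using int_P int_ln by simp
qed

text \<open>
  The rate at which the projection of the mixture approaches \<open>P\<close>, with a constant that does not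
  depend on the perturbing distribution.
\<close>

lemma KL_projection_mixture_L2_bound:
  fixes P :: "(real ^ 'd) measure"
  assumes proj: "is_KL_projection \<M> P \<nu> (mixture e P H) P1"
    and P: "P \<in> \<M>" "prob_space P"
    and \<nu>: "sigma_finite_measure \<nu>" "absolutely_continuous \<nu> P"
    and H: "prob_space H" "absolutely_continuous P H" "integrable P (\<lambda>u. (dens P H u)\<^sup>2)"
    and P1: "prob_space P1"
    and sets: "sets P = sets \<nu>" "sets H = sets P" "sets P1 = sets P"
    and bounds: "AE u in P. m0 \<le> dens P P1 u \<and> dens P P1 u \<le> m1" and m0: "0 < m0"
    and e: "0 \<le> e" "e \<le> 1"
  shows "(L2norm P (\<lambda>u. dens P P1 u - 1))\<^sup>2
    \<le> (2 * m1 / m0 * e)\<^sup>2 * ((L2norm P (dens P H))\<^sup>2 - 1)"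
proof -
  interpret P: prob_space P by fact
  let ?w = "\<lambda>u. 1 + e * (dens P H u - 1)"
  have mix: "mixture e P H = density P (\<lambda>u. ennreal (?w u))"
    by (rule mixture_eq_density) (use P H sets e in auto)
  have w_nonneg: "0 \<le> ?w u" for u
  proof -
    have "?w u = (1 - e) + e * dens P H u" by (simp add: algebra_simps)
    moreover have "0 \<le> e * dens P H u" using e dens_nonneg[of P H u] by simp
    ultimately show ?thesis using e by linarith
  qed
  have ac: "absolutely_continuous P P1"
    using proj by (auto simp: is_KL_projection_def is_arg_max_linorder)
  have fin: "finite_measure (mixture e P H)"
  proof
    interpret H: prob_space H by fact
    have "emeasure (mixture e P H) (space P) = ennreal (1 - e) + ennreal e"
      using H.emeasure_space_1 sets_eq_imp_space_eq[OF sets(2)]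
      by (simp add: emeasure_mixture[OF sets(2)] P.emeasure_space_1)
    then show "emeasure (mixture e P H) (space (mixture e P H)) \<noteq> \<infinity>" by simp
  qed
  have ac_mix: "absolutely_continuous P (mixture e P H)"
    unfolding mix by (rule absolutely_continuousI_density) measurable
  have "0 \<le> (\<integral>u. ln (dens P P1 u) \<partial>mixture e P H)"
    using KL_projection_ln_dens_nonneg[OF proj P \<nu> fin ac_mix P1 sets(1) _ sets(3) bounds m0]
    by simp
  also have "\<dots> = (\<integral>u. ?w u * ln (dens P P1 u) \<partial>P)"
    unfolding mix using w_nonneg by (subst integral_density) auto
  finally have gain: "0 \<le> (\<integral>u. ?w u * ln (dens P P1 u) \<partial>P)" .
  have "(\<integral>u. (dens P P1 u - 1)\<^sup>2 \<partial>P)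
      \<le> (2 * m1 / m0 * e)\<^sup>2 * ((\<integral>u. (dens P H u)\<^sup>2 \<partial>P) - 1)"
    by (rule P.L2_bound_of_ln_gain[OF _ _ m0 e(1) bounds _ _ H(3) gain])
      (simp_all add: integral_dens_eq_1 P.sigma_finite_measure H P1 ac sets)
  then show ?thesis by (simp add: L2norm_def)
qed

section \<open>The remainder\<close>

theorem theorem4:
  fixes \<M> :: "(real ^ 'd) measure set"
    and \<X> :: "(real ^ 'd) measure \<Rightarrow> (real ^ 'd) set"
    and \<Psi> :: "(real ^ 'd) measure \<Rightarrow> real"
    and \<phi> :: "(real ^ 'd) measure \<Rightarrow> real ^ 'd \<Rightarrow> real"
    and P \<nu> :: "(real ^ 'd) measure"
    and x :: "real ^ 'd"
    and G :: "(real ^ 'd \<Rightarrow> real) set"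
    and H :: "real \<Rightarrow> (real ^ 'd) measure"
    and Pstar :: "real \<Rightarrow> real \<Rightarrow> (real ^ 'd) measure"
    and r :: "real \<Rightarrow> real"
    and m0 m1 C :: real
  assumes model: "statistical_model \<M> \<X>"
    and pathwise: "\<And>Q. Q \<in> \<M> \<Longrightarrow> pathwise_differentiable \<M> \<Psi> Q"
    and EIF: "\<And>Q. Q \<in> \<M> \<Longrightarrow> is_EIF \<M> \<Psi> Q (\<phi> Q)"
    and P: "P \<in> \<M>" and x: "x \<in> \<X> P"
    and \<nu>: "sigma_finite_measure \<nu>" "sets \<nu> = sets borel" "absolutely_continuous \<nu> P"
    and H: "approximating_family P x G H"
    and H_L2: "\<And>l. l > 0 \<Longrightarrow> integrable P (\<lambda>u. (dens P (H l) u)\<^sup>2)"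
    and r: "\<And>l. r l = L2norm P (dens P (H l))"
    and projection: "\<exists>\<delta>>0. \<forall>e l. 0 < e \<and> e < \<delta> \<and> 0 < l \<and> l < \<delta> \<longrightarrow>
        is_KL_projection \<M> P \<nu> (mixture e P (H l)) (Pstar e l)"
    and I0: "0 < m0" "m0 \<le> m1"
    and Pstar_I0: "\<exists>l1>0. \<forall>l. 0 < l \<and> l < l1 \<longrightarrow> (\<exists>e1>0. \<forall>e. 0 < e \<and> e < e1 \<longrightarrow>
        (AE u in P. ennreal m0 \<le> RN_deriv P (Pstar e l) u \<and>
                    RN_deriv P (Pstar e l) u \<le> ennreal m1))"
    and EIF_integrable: "\<And>P1. P1 \<in> \<M> \<Longrightarrow> absolutely_continuous P P1 \<Longrightarrow>
        (AE u in P. RN_deriv P P1 u \<le> ennreal m1) \<Longrightarrow> integrable P (\<phi> P1)"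
    and C: "0 < C"
    and R_bound: "\<And>P1. P1 \<in> \<M> \<Longrightarrow> absolutely_continuous P P1 \<Longrightarrow>
        (AE u in P. RN_deriv P P1 u \<le> ennreal m1) \<Longrightarrow>
        \<bar>remainder \<Psi> \<phi> P1 P\<bar> \<le> C * (L2norm P (\<lambda>u. dens P P1 u - 1))\<^sup>2"
  shows "\<exists>B l0 e0. l0 > 0 \<and> (\<forall>l. 0 < l \<and> l < l0 \<longrightarrow> e0 l > 0) \<and>
      (\<forall>l e. 0 < l \<and> l < l0 \<and> 0 < e \<and> e < e0 l \<longrightarrow>
        \<bar>remainder \<Psi> \<phi> (Pstar e l) P\<bar> \<le> B * (e * (1 + r l))\<^sup>2) \<and>
      (\<forall>eps. (\<forall>l. 0 < l \<and> l < l0 \<longrightarrow> 0 < eps l \<and> eps l < e0 l) \<and>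
        ((\<lambda>l. eps l * (1 + r l)\<^sup>2) \<longlongrightarrow> 0) (at_right 0) \<longrightarrow>
        ((\<lambda>l. remainder \<Psi> \<phi> (Pstar (eps l) l) P / eps l) \<longlongrightarrow> 0) (at_right 0))"
proof -
  from projection obtain \<delta> where \<delta>: "\<delta> > 0" and
    proj: "\<forall>e l. 0 < e \<and> e < \<delta> \<and> 0 < l \<and> l < \<delta> \<longrightarrow>
        is_KL_projection \<M> P \<nu> (mixture e P (H l)) (Pstar e l)" by (elim exE conjE)
  let ?in_I0 = "\<lambda>l e. AE u in P. ennreal m0 \<le> RN_deriv P (Pstar e l) u \<and>
      RN_deriv P (Pstar e l) u \<le> ennreal m1"
  from Pstar_I0 obtain l1 where l1: "l1 > 0" and
    "\<forall>l. 0 < l \<and> l < l1 \<longrightarrow> (\<exists>e1>0. \<forall>e. 0 < e \<and> e < e1 \<longrightarrow> ?in_I0 l e)" by (elim exE conjE)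
  then have "\<exists>e1. \<forall>l. 0 < l \<and> l < l1 \<longrightarrow> e1 l > 0 \<and> (\<forall>e. 0 < e \<and> e < e1 l \<longrightarrow> ?in_I0 l e)"
    by (intro choice) (simp only: ex_simps)
  then obtain e1 where
    e1: "\<forall>l. 0 < l \<and> l < l1 \<longrightarrow> e1 l > 0 \<and> (\<forall>e. 0 < e \<and> e < e1 l \<longrightarrow> ?in_I0 l e)" ..
  define l0 where "l0 = min \<delta> l1"
  \<comment> \<open>Beyond \<open>e = 1\<close> the mixture would put negative weight on \<open>P\<close>.\<close>
  define e0 where "e0 l = min (min \<delta> (e1 l)) 1" for l
  define B where "B = C * (2 * m1 / m0)\<^sup>2"
  have B: "0 \<le> B" using C by (simp add: B_def)
  have r_nonneg: "0 \<le> r l" for l by (simp add: r L2norm_def)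
  have M_prob: "prob_space Q" and M_sets: "sets Q = sets borel" if "Q \<in> \<M>" for Q
    using model that by (auto simp: statistical_model_def)
  interpret P: prob_space P by (rule M_prob[OF P])
  have bound: "\<bar>remainder \<Psi> \<phi> (Pstar e l) P\<bar> \<le> B * (e * (1 + r l))\<^sup>2"
    if "0 < l" "l < l0" "0 < e" "e < e0 l" for l e
  proof -
    have small: "l < \<delta>" "l < l1" "e < \<delta>" "e < e1 l" "e \<le> 1"
      using that by (auto simp: l0_def e0_def)
    let ?S = "Pstar e l"
    have pr: "is_KL_projection \<M> P \<nu> (mixture e P (H l)) ?S" using proj that small by simp
    then have S: "?S \<in> \<M>" "absolutely_continuous P ?S"
      by (auto simp: is_KL_projection_def is_arg_max_linorder)
    have AE: "AE u in P. ennreal m0 \<le> RN_deriv P ?S u \<and> RN_deriv P ?S u \<le> ennreal m1"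
      using e1 that small by simp
    have sets_S: "sets ?S = sets P" using M_sets[OF P] M_sets[OF S(1)] by simp
    have bounds: "AE u in P. m0 \<le> dens P ?S u \<and> dens P ?S u \<le> m1"
      using AE AE_ennreal_dens[OF P.sigma_finite_measure M_prob[OF S(1)] S(2) sets_S]
    proof eventually_elim
      case (elim u)
      then show ?case using I0 dens_nonneg[of P ?S u] by simp
    qed
    have Hl: "prob_space (H l)" "sets (H l) = sets borel" "absolutely_continuous P (H l)"
      using H that by (auto simp: approximating_family_def)
    have "(L2norm P (\<lambda>u. dens P ?S u - 1))\<^sup>2 \<le> (2 * m1 / m0 * e)\<^sup>2 * ((r l)\<^sup>2 - 1)"
      unfolding r
      by (rule KL_projection_mixture_L2_bound[OF pr P P.prob_space_axioms \<nu>(1,3) Hl(1,3)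
            H_L2[OF that(1)] M_prob[OF S(1)] _ _ sets_S bounds I0(1)])
        (use \<nu>(2) M_sets[OF P] Hl(2) that small in auto)
    also have "\<dots> \<le> (2 * m1 / m0 * e)\<^sup>2 * (1 + r l)\<^sup>2"
    proof (rule mult_left_mono)
      show "(r l)\<^sup>2 - 1 \<le> (1 + r l)\<^sup>2"
        using r_nonneg[of l] by (simp add: power2_eq_square algebra_simps)
    qed simp
    finally have L2: "(L2norm P (\<lambda>u. dens P ?S u - 1))\<^sup>2 \<le> (2 * m1 / m0 * e)\<^sup>2 * (1 + r l)\<^sup>2" .
    have "\<bar>remainder \<Psi> \<phi> ?S P\<bar> \<le> C * (L2norm P (\<lambda>u. dens P ?S u - 1))\<^sup>2"
      using AE by (intro R_bound S) (auto elim: eventually_mono)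
    also have "\<dots> \<le> C * ((2 * m1 / m0 * e)\<^sup>2 * (1 + r l)\<^sup>2)"
      using L2 C by (intro mult_left_mono) auto
    also have "\<dots> = B * (e * (1 + r l))\<^sup>2" unfolding B_def power_mult_distrib by (simp only: mult_ac)
    finally show ?thesis .
  qed
  have l0: "0 < l0" using \<delta> l1 by (simp add: l0_def)
  have e0: "0 < e0 l" if "0 < l" "l < l0" for l
    using \<delta> e1 that by (auto simp: e0_def l0_def)
  have limit: "((\<lambda>l. remainder \<Psi> \<phi> (Pstar (eps l) l) P / eps l) \<longlongrightarrow> 0) (at_right 0)"
    if eps: "\<And>l. 0 < l \<Longrightarrow> l < l0 \<Longrightarrow> 0 < eps l \<and> eps l < e0 l"
      and lim: "((\<lambda>l. eps l * (1 + r l)\<^sup>2) \<longlongrightarrow> 0) (at_right 0)" for eps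
  proof (rule Lim_null_comparison)
    show "((\<lambda>l. B * (eps l * (1 + r l)\<^sup>2)) \<longlongrightarrow> 0) (at_right 0)"
      using tendsto_mult_left[OF lim, of B] by simp
    have "norm (remainder \<Psi> \<phi> (Pstar (eps l) l) P / eps l) \<le> B * (eps l * (1 + r l)\<^sup>2)"
      if l: "0 < l" "l < l0" for l
    proof -
      have ep: "0 < eps l" "eps l < e0 l" using eps l by auto
      have "norm (remainder \<Psi> \<phi> (Pstar (eps l) l) P / eps l)
          = \<bar>remainder \<Psi> \<phi> (Pstar (eps l) l) P\<bar> / eps l" using ep by simp
      also have "\<dots> \<le> B * (eps l * (1 + r l))\<^sup>2 / eps l"
        using bound[OF l ep] ep by (intro divide_right_mono) auto
      also have "\<dots> = B * (eps l * (1 + r l)\<^sup>2)"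
        using ep by (simp add: power2_eq_square)
      finally show ?thesis .
    qed
    then show "\<forall>\<^sub>F l in at_right 0.
        norm (remainder \<Psi> \<phi> (Pstar (eps l) l) P / eps l) \<le> B * (eps l * (1 + r l)\<^sup>2)"
      unfolding eventually_at_right_field using l0 by blast
  qed
  show ?thesis
  proof (rule exI[of _ B], rule exI[of _ l0], rule exI[of _ e0], intro conjI allI impI)
    show "0 < l0" by (rule l0)
  qed (simp_all add: e0 bound limit)
qed

end
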